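(* Let $1\le k\le n$ be integers, let $t\ge 1$ be real, and let $\hat{\mathbf r}=[\hat r_1,\dots,\hat r_n]\in\mathbb R^n$ be keys. Let $\mathbf a=[a_1,\dots,a_n]$ be the output vector of the successive-softmax top-$k$ relaxation (defined in the context) applied to $\hat{\mathbf r}$ with $k$ steps and temperature $t$. Then for all indices $i,j\in\{1,\dots,n\}$, if $\hat r_i\le\hat r_j$ then $a_i\le a_j$.
   Context: The successive-softmax top-$k$ relaxation with keys $\hat{\mathbf r}\in\mathbb R^n$, number of steps $k\le n$, and temperature $t>0$ is defined as follows. Set $\alpha_i^{1}=\hat r_i$ for $i=1,\dots,n$. For steps $s=1,\dots,k$ define $$p_i^{s}=\frac{\exp(\alpha_i^{s}/t)}{\sum_{m=1}^n\exp(\alpha_m^{s}/t)},\qquad i=1,\dots,n,$$ and, for $s<k$, update $$\alpha_i^{s+1}=\alpha_i^{s}+\log(1-p_i^{s}),\qquad i=1,\dots,n.$$ (Superscripts are step indices, not powers.) The output is the vector $\mathbf a=[a_1,\dots,a_n]$ with $a_i=\sum_{s=1}^{k}p_i^{s}$. *)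

theory Defs
  imports "HOL-Analysis.Analysis"
begin

definition softmax :: "real \<Rightarrow> real ^ 'n \<Rightarrow> real ^ 'n::finite" where
  "softmax t \<alpha> = (\<chi> i. exp (\<alpha> $ i / t) / (\<Sum>m\<in>UNIV. exp (\<alpha> $ m / t)))"

(* Steps are counted from 0: topk_logits t r s and topk_probs t r s are the vectors
   alpha and p of the (s+1)-st step.  In the relaxation with k steps only the steps s < k
   are used, so for k <= CARD('n) the argument of ln in every update that matters is
   positive: such an update requires k >= 2, hence CARD('n) >= 2 and every softmax
   entry is strictly below 1. *)

primrec topk_logits :: "real \<Rightarrow> real ^ 'n \<Rightarrow> nat \<Rightarrow> real ^ 'n::finite" where
  "topk_logits t r 0 = r"
| "topk_logits t r (Suc s) =
     (\<chi> i. topk_logits t r s $ i + ln (1 - softmax t (topk_logits t r s) $ i))"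

definition topk_probs :: "real \<Rightarrow> real ^ 'n \<Rightarrow> nat \<Rightarrow> real ^ 'n::finite" where
  "topk_probs t r s = softmax t (topk_logits t r s)"

definition topk_relaxation :: "nat \<Rightarrow> real \<Rightarrow> real ^ 'n \<Rightarrow> real ^ 'n::finite" where
  "topk_relaxation k t r = (\<chi> i. \<Sum>s<k. topk_probs t r s $ i)"

end

(* Each single step preserves the order of the logits. Indeed, if p_i <= p_j for i \<noteq> j, then
   p_i + p_j <= 1 gives p_i (1 - p_i) <= p_j (1 - p_j), that is
   ln (1 - p_i) - ln (1 - p_j) <= ln p_j - ln p_i = (alpha_j - alpha_i) / t <= alpha_j - alpha_i,
   where the last inequality uses t >= 1. *)
theory Submission
  imports Defs
begin

lemma softmax_denominator_pos: "(\<Sum>m\<in>UNIV. exp (\<alpha> $ m / t)) > (0 :: real)"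
  for \<alpha> :: "real ^ 'n::finite"
  by (intro sum_pos) auto

lemma softmax_pos: "softmax t \<alpha> $ i > 0"
  using softmax_denominator_pos[of \<alpha> t] by (simp add: softmax_def)

lemma sum_softmax: "(\<Sum>i\<in>UNIV. softmax t \<alpha> $ i) = 1"
  using softmax_denominator_pos[of \<alpha> t]
  by (simp add: softmax_def flip: sum_divide_distrib)

text \<open>Two entries of a probability vector cannot exceed its total mass. For positive entries
  this also keeps each of the two strictly below 1.\<close>

lemma softmax_add_le_1:
  assumes "i \<noteq> j"
  shows "softmax t \<alpha> $ i + softmax t \<alpha> $ j \<le> 1"
proof -
  have "(\<Sum>m\<in>{i, j}. softmax t \<alpha> $ m) \<le> (\<Sum>m\<in>UNIV. softmax t \<alpha> $ m)"
    by (intro sum_mono2) (auto intro: less_imp_le softmax_pos)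
  then show ?thesis
    using assms by (simp add: sum_softmax)
qed

lemma softmax_mono:
  assumes "\<alpha> $ i \<le> \<alpha> $ j" and "t > 0"
  shows "softmax t \<alpha> $ i \<le> softmax t \<alpha> $ j"
  using assms softmax_denominator_pos[of \<alpha> t]
  by (simp add: softmax_def divide_right_mono)

text \<open>Both entries share the normalising denominator, so its logarithm cancels.\<close>

lemma ln_softmax_diff:
  "ln (softmax t \<alpha> $ j) - ln (softmax t \<alpha> $ i) = (\<alpha> $ j - \<alpha> $ i) / t"
  using softmax_denominator_pos[of \<alpha> t]
  by (simp add: softmax_def ln_div diff_divide_distrib)

text \<open>The difference of the two sides factors as
  \<open>(q - p) * (1 - (p + q))\<close>.\<close>

lemma mult_one_minus_mono:
  fixes p q :: "'a::linordered_idom"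
  assumes "p \<le> q" and "p + q \<le> 1"
  shows "p * (1 - p) \<le> q * (1 - q)"
proof -
  have "0 \<le> (q - p) * (1 - (p + q))"
    using assms by simp
  then show ?thesis
    by (simp add: algebra_simps)
qed

lemma softmax_update_mono:
  assumes le: "\<alpha> $ i \<le> \<alpha> $ j" and t: "t \<ge> 1"
  shows "\<alpha> $ i + ln (1 - softmax t \<alpha> $ i) \<le> \<alpha> $ j + ln (1 - softmax t \<alpha> $ j)"
\<comment> \<open>The diagonal case is split off because \<open>p + q \<le> 1\<close> is available
  only for distinct indices.\<close>
proof (cases "i = j")
  case False
  define p q where "p = softmax t \<alpha> $ i" and "q = softmax t \<alpha> $ j"
  have pos: "0 < p" "0 < q" and sum: "p + q \<le> 1"
    using False by (simp_all add: p_def q_def softmax_pos softmax_add_le_1)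
  have "p \<le> q"
    using le t by (simp add: p_def q_def softmax_mono)
  \<comment> \<open>Since \<open>p\<close> and \<open>q\<close> are positive with sum at most 1,
    both are below 1, so every logarithm here and in the next step has a positive argument.\<close>
  then have "ln (p * (1 - p)) \<le> ln (q * (1 - q))"
    using pos sum by (intro ln_mono mult_one_minus_mono) auto
  then have "ln (1 - p) - ln (1 - q) \<le> ln q - ln p"
    using pos sum by (simp add: ln_mult)
  also have "\<dots> = (\<alpha> $ j - \<alpha> $ i) / t"
    by (simp add: p_def q_def ln_softmax_diff)
  also have "\<dots> \<le> \<alpha> $ j - \<alpha> $ i"
    using le t by (simp add: divide_le_eq mult_le_cancel_left1)
  finally show ?thesis
    by (simp add: p_def q_def)
qed simp

lemma topk_logits_mono:
  assumes "r $ i \<le> r $ j" and "t \<ge> 1"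
  shows "topk_logits t r s $ i \<le> topk_logits t r s $ j"
  using assms by (induction s) (simp_all add: softmax_update_mono)

theorem theorem1:
  fixes r :: "real ^ 'n::finite" and k :: nat and t :: real
  assumes "1 \<le> k" and "k \<le> CARD('n)" and "t \<ge> 1"
  shows "\<forall>i j. r $ i \<le> r $ j \<longrightarrow>
           topk_relaxation k t r $ i \<le> topk_relaxation k t r $ j"
  \<comment> \<open>The outputs are compared summand by summand: at each step the logits are still
    ordered, and softmax passes that order on to the probabilities.\<close>
  using \<open>t \<ge> 1\<close>
  by (auto simp: topk_relaxation_def topk_probs_def intro!: sum_mono softmax_mono topk_logits_mono)

end
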